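(* Let $K\ge 1$. Suppose that $f(z)=h(z)+\overline{g(z)}=\sum_{n=0}^{\infty}a_n z^n+\overline{\sum_{n=1}^{\infty}b_n z^n}$ is a $K$-quasiconformal sense-preserving harmonic mapping in $\mathbb{D}$ and $h\prec \varphi$, where $\varphi$ is analytic, univalent and convex in $\mathbb{D}$. Then $$\sum_{n=1}^{\infty}(|a_n|+|b_n|)r^n\leq \operatorname{dist}(\varphi(0),\partial\varphi(\mathbb{D}))\quad\text{for } |z|=r\leq \frac{K+1}{5K+1}.$$ The result is sharp: for each $K\ge 1$ the number $\frac{K+1}{5K+1}$ cannot be replaced by any larger number (that is, for every $\rho\in\left(\frac{K+1}{5K+1},1\right)$ there exist $f$ and $\varphi$ satisfying the hypotheses for which the inequality fails for some $r\le\rho$).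
   Context: $\mathbb{D}=\{z\in\mathbb{C}:|z|<1\}$. A harmonic mapping $f$ in $\mathbb{D}$ is a complex-valued function whose real and imaginary parts are harmonic; it is written $f=h+\overline{g}$ with $h,g$ analytic in $\mathbb{D}$ and $g(0)=0$, $h(z)=\sum_{n\ge 0}a_nz^n$, $g(z)=\sum_{n\ge 1}b_nz^n$. A locally univalent harmonic mapping $f=h+\overline{g}$ is sense-preserving if $|h'(z)|^2-|g'(z)|^2>0$ in $\mathbb{D}$ (equivalently, the dilatation $\omega=g'/h'$ is analytic and maps $\mathbb{D}$ into itself). A locally univalent sense-preserving harmonic mapping is called $K$-quasiconformal if $|g'(z)/h'(z)|\le k<1$ in $\mathbb{D}$, where $K=\frac{1+k}{1-k}\ge 1$, i.e. $k=\frac{K-1}{K+1}$. For analytic $h,\varphi$ in $\mathbb{D}$ with $h(0)=\varphi(0)$, $h\prec\varphi$ ($h$ is subordinate to $\varphi$) means $h(z)=\varphi(w(z))$ for some analytic $w$ on $\mathbb{D}$ with $|w(z)|\le|z|$. A univalent $\varphi$ is convex if $\varphi(\mathbb{D})$ is a convex domain. $\operatorname{dist}(\varphi(0),\partial\varphi(\mathbb{D}))$ is the Euclidean distance from $\varphi(0)$ to the boundary of $\varphi(\mathbb{D})$. *)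

theory Defs
  imports "HOL-Complex_Analysis.Complex_Analysis"
begin

abbreviation unit_disk :: "complex set"
  where "unit_disk \<equiv> ball 0 1"

(* Twice continuously differentiable with vanishing Laplacian on the open set S, a complex number
   being identified with the point (Re z, Im z) of the plane. The witnesses are the first and second
   order partial derivatives of u; uxy is the y-derivative of ux, uyx the x-derivative of uy. *)
definition harmonic_real :: "(complex \<Rightarrow> real) \<Rightarrow> complex set \<Rightarrow> bool" where
  "harmonic_real u S \<longleftrightarrow> open S \<and>
     (\<exists>ux uy uxx uxy uyx uyy :: complex \<Rightarrow> real.
        (\<forall>z\<in>S. (u has_derivative (\<lambda>v. ux z * Re v + uy z * Im v)) (at z)) \<and>
        (\<forall>z\<in>S. (ux has_derivative (\<lambda>v. uxx z * Re v + uxy z * Im v)) (at z)) \<and>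
        (\<forall>z\<in>S. (uy has_derivative (\<lambda>v. uyx z * Re v + uyy z * Im v)) (at z)) \<and>
        continuous_on S uxx \<and> continuous_on S uxy \<and>
        continuous_on S uyx \<and> continuous_on S uyy \<and>
        (\<forall>z\<in>S. uxx z + uyy z = 0))"

definition harmonic_mapping :: "(complex \<Rightarrow> complex) \<Rightarrow> bool" where
  "harmonic_mapping f \<longleftrightarrow>
     harmonic_real (\<lambda>z. Re (f z)) unit_disk \<and> harmonic_real (\<lambda>z. Im (f z)) unit_disk"

definition canonical_decomposition ::
    "(complex \<Rightarrow> complex) \<Rightarrow> (complex \<Rightarrow> complex) \<Rightarrow> (complex \<Rightarrow> complex) \<Rightarrow> bool" where
  "canonical_decomposition f h g \<longleftrightarrow>
     h holomorphic_on unit_disk \<and> g holomorphic_on unit_disk \<and> g 0 = 0 \<and>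
     (\<forall>z\<in>unit_disk. f z = h z + cnj (g z))"

definition locally_univalent :: "(complex \<Rightarrow> complex) \<Rightarrow> bool" where
  "locally_univalent f \<longleftrightarrow>
     (\<forall>z\<in>unit_disk. \<exists>U. open U \<and> z \<in> U \<and> U \<subseteq> unit_disk \<and> inj_on f U)"

definition sense_preserving_harmonic ::
    "(complex \<Rightarrow> complex) \<Rightarrow> (complex \<Rightarrow> complex) \<Rightarrow> (complex \<Rightarrow> complex) \<Rightarrow> bool" where
  "sense_preserving_harmonic f h g \<longleftrightarrow>
     harmonic_mapping f \<and> canonical_decomposition f h g \<and> locally_univalent f \<and>
     (\<forall>z\<in>unit_disk. (cmod (deriv h z))\<^sup>2 - (cmod (deriv g z))\<^sup>2 > 0)"

definition quasiconformal_harmonic ::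
    "real \<Rightarrow> (complex \<Rightarrow> complex) \<Rightarrow> (complex \<Rightarrow> complex) \<Rightarrow> (complex \<Rightarrow> complex) \<Rightarrow> bool" where
  "quasiconformal_harmonic K f h g \<longleftrightarrow>
     sense_preserving_harmonic f h g \<and>
     (\<forall>z\<in>unit_disk. cmod (deriv g z / deriv h z) \<le> (K - 1) / (K + 1))"

definition subordinate :: "(complex \<Rightarrow> complex) \<Rightarrow> (complex \<Rightarrow> complex) \<Rightarrow> bool" where
  "subordinate h \<phi> \<longleftrightarrow> h 0 = \<phi> 0 \<and>
     (\<exists>w. w holomorphic_on unit_disk \<and>
          (\<forall>z\<in>unit_disk. cmod (w z) \<le> cmod z \<and> h z = \<phi> (w z)))"

definition convex_univalent :: "(complex \<Rightarrow> complex) \<Rightarrow> bool" where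
  "convex_univalent \<phi> \<longleftrightarrow>
     \<phi> holomorphic_on unit_disk \<and> inj_on \<phi> unit_disk \<and> convex (\<phi> ` unit_disk)"

(* The coefficient b 0 is irrelevant: the series of g starts with the linear term. *)
definition admissible :: "real \<Rightarrow> (complex \<Rightarrow> complex) \<Rightarrow> (complex \<Rightarrow> complex) \<Rightarrow>
    (complex \<Rightarrow> complex) \<Rightarrow> (nat \<Rightarrow> complex) \<Rightarrow> (nat \<Rightarrow> complex) \<Rightarrow> (complex \<Rightarrow> complex) \<Rightarrow> bool" where
  "admissible K f h g a b \<phi> \<longleftrightarrow>
     quasiconformal_harmonic K f h g \<and>
     (\<forall>z\<in>unit_disk. (\<lambda>n. a n * z ^ n) sums h z) \<and>
     (\<forall>z\<in>unit_disk. (\<lambda>n. b (Suc n) * z ^ Suc n) sums g z) \<and>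
     convex_univalent \<phi> \<and> subordinate h \<phi>"

end

theory Submission
  imports Defs
begin

text \<open>
  A supporting line of the convex domain \<open>\<phi>(D)\<close> at a boundary point nearest to \<open>\<phi>(0)\<close> bounds a
  half-plane containing \<open>h(D)\<close>, so Caratheodory's inequality for functions with nonnegative real
  part gives \<open>|a\<^sub>n| \<le> 2 d\<close>, where \<open>d\<close> is the distance to the boundary; the boundary is nonempty by
  Liouville's theorem. For \<open>r \<le> 1/3\<close> the bound \<open>|g'| \<le> k |h'|\<close> passes to the majorant series, so
  the sum is at most \<open>(1 + k) 2 d r / (1 - r)\<close>, which is at most \<open>d\<close> exactly if
  \<open>r \<le> (K + 1) / (5 K + 1)\<close>, a number that does not exceed \<open>1/3\<close>. Equality throughout holds for
  \<open>\<phi>(z) = h(z) = z / (1 - z)\<close> and \<open>g = k h\<close>.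
\<close>

section \<open>Coefficients of functions with nonnegative real part\<close>

text \<open>Letting \<open>r\<close> tend to 1 from the left removes the radius from an estimate
  obtained on circles inside the disk.\<close>

lemma bound_of_bound_mult_power:
  fixes x M :: real
  assumes "\<And>r. 0 < r \<Longrightarrow> r < 1 \<Longrightarrow> x * r ^ n \<le> M"
  shows "x \<le> M"
proof -
  have "((\<lambda>r. x * r ^ n) \<longlongrightarrow> x * 1 ^ n) (at_left 1)"
    by (intro tendsto_intros)
  moreover have "eventually (\<lambda>r. x * r ^ n \<le> M) (at_left (1::real))"
    unfolding eventually_at_left_field using assms by (intro exI[of _ 0]) auto
  ultimately show ?thesis
    using tendsto_upperbound[of "\<lambda>r. x * r ^ n" "x * 1 ^ n" "at_left 1" M] by simp
qed

text \<open>On the circle of radius \<open>r\<close>, the \<open>n\<close>-th coefficient times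
  \<open>r ^ n\<close> is the mean of \<open>2 * Re F\<close> against a unimodular factor. Since
  \<open>Re F\<close> is nonnegative, its modulus is at most the mean of \<open>2 * Re F\<close>,
  which is \<open>2 * Re (F 0)\<close>.\<close>

lemma Caratheodory_coeff_bound:
  fixes F :: "complex \<Rightarrow> complex"
  assumes exp: "F has_fps_expansion A"
    and hol: "F holomorphic_on unit_disk"
    and pos: "\<And>z. z \<in> unit_disk \<Longrightarrow> 0 \<le> Re (F z)"
    and n: "n > 0"
  shows "cmod (fps_nth A n) \<le> 2 * Re (F 0)"
  unfolding fps_nth_fps_expansion[OF exp]
proof (rule bound_of_bound_mult_power[where n = n])
  fix r :: real assume r: "0 < r" "r < 1"
  define c where "c = (deriv ^^ n) F 0 / fact n"
  define \<Phi> where "\<Phi> t = F (of_real r * cis t)" for t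
  have holr: "F holomorphic_on cball 0 r"
    by (rule holomorphic_on_subset[OF hol]) (use r in auto)
  have cont: "continuous_on (cball 0 r) F" and holb: "F holomorphic_on ball 0 r"
    using holr holomorphic_on_imp_continuous_on holomorphic_on_subset by auto
  have path: "circlepath 0 r = part_circlepath 0 r 0 (2 * pi)"
    by (simp add: circlepath_def)
  have int: "((\<lambda>t. G (of_real r * cis t) * r * \<i> * cis t) has_integral I) {0..2*pi}"
    if "(G has_contour_integral I) (circlepath 0 r)" for G I
    using that has_contour_integral_part_circlepath_iff[of 0 "2*pi" G I 0 r]
    by (simp add: path)
  \<comment> \<open>Cauchy's formula for the derivative of order 0 is the mean value
    property.\<close>
  have "((\<lambda>t. 1 / \<i> * (F (of_real r * cis t) / (of_real r * cis t - 0) ^ Suc 0 * r * \<i> * cis t))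
      has_integral 1 / \<i> * (2 * pi * \<i> / fact 0 * (deriv ^^ 0) F 0)) {0..2*pi}"
    by (intro has_integral_mult_right int Cauchy_has_contour_integral_higher_derivative_circlepath
        cont holb) (use r in auto)
  then have I0: "(\<Phi> has_integral 2 * pi * F 0) {0..2*pi}"
    using r by (simp add: \<Phi>_def[abs_def] ac_simps)
  have "((\<lambda>t. of_real r ^ n / \<i> *
        (F (of_real r * cis t) / (of_real r * cis t - 0) ^ Suc n * r * \<i> * cis t))
      has_integral of_real r ^ n / \<i> * (2 * pi * \<i> / fact n * (deriv ^^ n) F 0)) {0..2*pi}"
    by (intro has_integral_mult_right int Cauchy_has_contour_integral_higher_derivative_circlepath
        cont holb) (use r in auto)
  \<comment> \<open>On the unit circle the inverse is the conjugate, and the factor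
    \<open>cis t\<close> of the differential lowers the exponent from \<open>Suc n\<close> to
    \<open>n\<close>.\<close>
  also have "(\<lambda>t. of_real r ^ n / \<i> *
        (F (of_real r * cis t) / (of_real r * cis t - 0) ^ Suc n * r * \<i> * cis t))
      = (\<lambda>t. \<Phi> t * cnj (cis t ^ n))"
    using r by (simp add: \<Phi>_def fun_eq_iff power_mult_distrib cis_cnj field_simps
        flip: cis_inverse)
  finally have In: "((\<lambda>t. \<Phi> t * cnj (cis t ^ n)) has_integral 2 * pi * r ^ n * c) {0..2*pi}"
    by (simp add: c_def field_simps)
  (* Together with the previous integral this replaces F by 2 * Re F in the formula for c. *)
  have "((\<lambda>u. F u * u ^ (n - 1)) has_contour_integral 0) (circlepath 0 r)"
    by (rule Cauchy_theorem_disc_simple[where a = 0 and e = 1])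
       (use hol r in \<open>auto intro!: holomorphic_intros\<close>)
  from int[OF this]
  have "((\<lambda>t. 1 / \<i> * (F (of_real r * cis t) * (of_real r * cis t) ^ (n - 1) * r * \<i> * cis t))
      has_integral 1 / \<i> * 0) {0..2*pi}"
    by (rule has_integral_mult_right)
  \<comment> \<open>Here the differential raises the exponent from \<open>n - 1\<close> to
    \<open>n\<close>, which is where \<open>n > 0\<close> enters.\<close>
  also have "(\<lambda>t. 1 / \<i> * (F (of_real r * cis t) * (of_real r * cis t) ^ (n - 1) * r * \<i> * cis t))
      = (\<lambda>t. of_real r ^ n * (\<Phi> t * cis t ^ n))"
    using n by (cases n) (auto simp: \<Phi>_def fun_eq_iff power_mult_distrib ac_simps)
  finally have "((\<lambda>t. 1 / of_real r ^ n * (of_real r ^ n * (\<Phi> t * cis t ^ n)))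
      has_integral 1 / of_real r ^ n * (1 / \<i> * 0)) {0..2*pi}"
    by (rule has_integral_mult_right)
  then have "((\<lambda>t. \<Phi> t * cis t ^ n) has_integral 0) {0..2*pi}"
    using r by simp
  then have Im: "((\<lambda>t. cnj (\<Phi> t * cis t ^ n)) has_integral 0) {0..2*pi}"
    by (subst (asm) has_integral_cnj[symmetric]) (simp add: o_def)
  have "((\<lambda>t. \<Phi> t * cnj (cis t ^ n) + cnj (\<Phi> t * cis t ^ n))
      has_integral 2 * pi * r ^ n * c + 0) {0..2*pi}"
    by (rule has_integral_add[OF In Im])
  also have "(\<lambda>t. \<Phi> t * cnj (cis t ^ n) + cnj (\<Phi> t * cis t ^ n))
      = (\<lambda>t. of_real (2 * Re (\<Phi> t)) * cnj (cis t ^ n))"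
    by (rule ext) (simp add: complex_eq_iff algebra_simps)
  finally have A: "((\<lambda>t. of_real (2 * Re (\<Phi> t)) * cnj (cis t ^ n))
      has_integral 2 * pi * r ^ n * c) {0..2*pi}"
    by simp
  have "((\<lambda>t. Re (\<Phi> t)) has_integral Re (2 * pi * F 0)) {0..2*pi}"
    using has_integral_linear[OF I0 bounded_linear_Re] by (simp add: o_def)
  then have B: "((\<lambda>t. 2 * Re (\<Phi> t)) has_integral 2 * Re (2 * pi * F 0)) {0..2*pi}"
    by (rule has_integral_mult_right)
  \<comment> \<open>Nonnegativity makes \<open>2 * Re (\<Phi> t)\<close> equal to the modulus of the
    integrand on the left.\<close>
  have "norm (integral {0..2*pi} (\<lambda>t. of_real (2 * Re (\<Phi> t)) * cnj (cis t ^ n)))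
      \<le> integral {0..2*pi} (\<lambda>t. 2 * Re (\<Phi> t))"
    using A B pos r by (intro integral_norm_bound_integral)
      (auto simp: norm_mult norm_power integrable_on_def \<Phi>_def)
  then have "cmod (2 * pi * r ^ n * c) \<le> 2 * Re (2 * pi * F 0)"
    by (simp only: integral_unique[OF A] integral_unique[OF B])
  then show "cmod c * r ^ n \<le> 2 * Re (F 0)"
    using r by (simp add: norm_mult norm_power)
qed


section \<open>Bohr's inequality\<close>

text \<open>A rotation makes the value at 0 nonnegative; then \<open>k - u * \<omega>\<close> has
  nonnegative real part and its value at 0 is \<open>m = k - cmod (\<omega> 0)\<close>.
  Caratheodory's inequality bounds every later coefficient by \<open>2 * m\<close>, and for
  \<open>r \<le> 1/3\<close> the resulting geometric tail is at most \<open>m\<close>, so it fills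
  at most the gap between \<open>cmod (\<omega> 0)\<close> and \<open>k\<close>.\<close>

lemma Bohr_inequality:
  assumes exp: "\<omega> has_fps_expansion W"
    and hol: "\<omega> holomorphic_on unit_disk"
    and bound: "\<And>z. z \<in> unit_disk \<Longrightarrow> cmod (\<omega> z) \<le> k"
    and r: "0 \<le> r" "r \<le> 1 / 3"
  shows "summable (\<lambda>n. cmod (fps_nth W n) * r ^ n)"
    and "(\<Sum>n. cmod (fps_nth W n) * r ^ n) \<le> k"
proof -
  \<comment> \<open>The case split keeps \<open>u\<close> unimodular, as
    \<open>sgn 0 = 0\<close>.\<close>
  define u where "u = (if \<omega> 0 = 0 then 1 else cnj (sgn (\<omega> 0)))"
  define m where "m = k - cmod (\<omega> 0)"
  have "\<omega> 0 * cnj (\<omega> 0) = of_real (cmod (\<omega> 0)) * of_real (cmod (\<omega> 0))"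
    by (metis complex_norm_square of_real_power power2_eq_square)
  then have u: "cmod u = 1" "u * \<omega> 0 = of_real (cmod (\<omega> 0))"
    by (simp add: u_def norm_sgn) (simp add: u_def sgn_eq field_simps \<open>\<omega> 0 * _ = _\<close>)
  have m: "m \<ge> 0"
    using bound[of 0] by (simp add: m_def)
  have "cmod (fps_nth W n) \<le> 2 * m" if "n > 0" for n
  proof -
    have "cmod (fps_nth (fps_const (of_real k) - fps_const u * W) n)
        \<le> 2 * Re (of_real k - u * \<omega> 0)"
    proof (rule Caratheodory_coeff_bound)
      show "(\<lambda>z. of_real k - u * \<omega> z) has_fps_expansion fps_const (of_real k) - fps_const u * W"
        by (intro fps_expansion_intros exp)
      show "0 \<le> Re (of_real k - u * \<omega> z)" if "z \<in> unit_disk" for z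
        using complex_Re_le_cmod[of "u * \<omega> z"] bound[OF that] u(1) by (simp add: norm_mult)
    qed (use hol that in \<open>auto intro!: holomorphic_intros\<close>)
    then show ?thesis
      using that u by (simp add: norm_mult m_def)
  qed
  then have le: "cmod (fps_nth W (Suc n)) * r ^ Suc n \<le> 2 * m * r * r ^ n" for n
    using mult_right_mono[of "cmod (fps_nth W (Suc n))" "2 * m" "r ^ Suc n"] r by (simp add: mult.assoc)
  have geom: "(\<lambda>n. 2 * m * r * r ^ n) sums (2 * m * r * (1 / (1 - r)))"
    using r by (intro sums_mult geometric_sums) auto
  have sum: "summable (\<lambda>n. cmod (fps_nth W (Suc n)) * r ^ Suc n)"
    by (rule summable_comparison_test'[OF sums_summable[OF geom], of 0])
      (use le r in \<open>auto simp: mult.assoc\<close>)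
  then show sumW: "summable (\<lambda>n. cmod (fps_nth W n) * r ^ n)"
    by (subst summable_Suc_iff[symmetric])
  have "(\<Sum>n. cmod (fps_nth W n) * r ^ n)
      = cmod (\<omega> 0) + (\<Sum>n. cmod (fps_nth W (Suc n)) * r ^ Suc n)"
    using suminf_split_head[OF sumW] fps_nth_fps_expansion[OF exp, of 0] by simp
  also have "(\<Sum>n. cmod (fps_nth W (Suc n)) * r ^ Suc n) \<le> 2 * m * r * (1 / (1 - r))"
    using suminf_le[OF le sum sums_summable[OF geom]] geom by (simp add: sums_iff)
  also have "\<dots> = m * (2 * r / (1 - r))"
    by simp
  \<comment> \<open>The condition \<open>2 * r / (1 - r) \<le> 1\<close> is exactly
    \<open>r \<le> 1/3\<close>.\<close>
  also have "\<dots> \<le> m * 1"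
    using r m by (intro mult_left_mono) (auto simp: field_simps)
  finally show "(\<Sum>n. cmod (fps_nth W n) * r ^ n) \<le> k"
    by (simp add: m_def)
qed

section \<open>Majorant series and the dilatation\<close>

lemma summable_norm_fps_expansion:
  assumes "F has_fps_expansion A" "F holomorphic_on unit_disk" "0 \<le> r" "r < 1"
  shows "summable (\<lambda>n. cmod (fps_nth A n) * r ^ n)"
proof -
  have "ereal 1 \<le> fps_conv_radius A"
    by (rule holomorphic_on_imp_fps_conv_radius_ge) (use assms in auto)
  then have "ereal (norm (complex_of_real r)) < fps_conv_radius A"
    by (rule less_le_trans[rotated]) (use assms in simp)
  from norm_summable_fps[OF this] show ?thesis
    using assms(3) by (simp add: norm_mult norm_power)
qed

text \<open>Submultiplicativity of the majorant series: the triangle inequality bounds each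
  convolution coefficient, and the bounds sum to the Cauchy product.\<close>

lemma suminf_norm_fps_mult_le:
  fixes A B :: "complex fps"
  assumes "summable (\<lambda>n. cmod (fps_nth A n) * t ^ n)" "summable (\<lambda>n. cmod (fps_nth B n) * t ^ n)"
    and "summable (\<lambda>n. cmod (fps_nth (A * B) n) * t ^ n)" and t: "0 \<le> t"
  shows "(\<Sum>n. cmod (fps_nth (A * B) n) * t ^ n)
    \<le> (\<Sum>n. cmod (fps_nth A n) * t ^ n) * (\<Sum>n. cmod (fps_nth B n) * t ^ n)"
proof -
  have prod: "(\<lambda>n. \<Sum>i\<le>n. (cmod (fps_nth A i) * t ^ i) * (cmod (fps_nth B (n - i)) * t ^ (n - i)))
      sums ((\<Sum>n. cmod (fps_nth A n) * t ^ n) * (\<Sum>n. cmod (fps_nth B n) * t ^ n))"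
    by (rule Cauchy_product_sums) (use assms in \<open>auto simp: abs_mult\<close>)
  have "cmod (fps_nth (A * B) n) * t ^ n
      \<le> (\<Sum>i\<le>n. (cmod (fps_nth A i) * t ^ i) * (cmod (fps_nth B (n - i)) * t ^ (n - i)))" for n
  proof -
    have "cmod (fps_nth (A * B) n) \<le> (\<Sum>i\<le>n. cmod (fps_nth A i) * cmod (fps_nth B (n - i)))"
      unfolding fps_mult_nth atLeast0AtMost
      by (rule order_trans[OF norm_sum]) (simp add: norm_mult)
    then have "cmod (fps_nth (A * B) n) * t ^ n
        \<le> (\<Sum>i\<le>n. cmod (fps_nth A i) * cmod (fps_nth B (n - i))) * t ^ n"
      using t by (intro mult_right_mono) auto
    also have "\<dots> = (\<Sum>i\<le>n. (cmod (fps_nth A i) * t ^ i) * (cmod (fps_nth B (n - i)) * t ^ (n - i)))"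
      unfolding sum_distrib_right
    proof (rule sum.cong[OF refl])
      fix i assume "i \<in> {..n}"
      then have "t ^ n = t ^ i * t ^ (n - i)"
        by (simp flip: power_add)
      then show "cmod (fps_nth A i) * cmod (fps_nth B (n - i)) * t ^ n
          = (cmod (fps_nth A i) * t ^ i) * (cmod (fps_nth B (n - i)) * t ^ (n - i))"
        by (simp only: mult_ac)
    qed
    finally show ?thesis .
  qed
  from suminf_le[OF this assms(3) sums_summable[OF prod]] prod show ?thesis
    by (simp add: sums_iff)
qed

text \<open>With \<open>\<omega> = g' / h'\<close>, Bohr's inequality compares the majorant series of
  \<open>g' = \<omega> h'\<close> and \<open>h'\<close> on \<open>[0, 1/3]\<close>; integrating from \<open>0\<close> to \<open>r\<close> compares those of
  \<open>g\<close> and \<open>h\<close>. The integration is done by monotonicity of the difference \<open>P\<close>.\<close>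

lemma dilatation_majorant_le:
  assumes A: "h has_fps_expansion A" "h holomorphic_on unit_disk"
    and B: "g has_fps_expansion B" "g holomorphic_on unit_disk"
    and nz: "\<And>z. z \<in> unit_disk \<Longrightarrow> deriv h z \<noteq> 0"
    and dil: "\<And>z. z \<in> unit_disk \<Longrightarrow> cmod (deriv g z / deriv h z) \<le> k"
    and r: "0 \<le> r" "r \<le> 1 / 3"
  shows "(\<Sum>n. cmod (fps_nth B (Suc n)) * r ^ Suc n) \<le> k * (\<Sum>n. cmod (fps_nth A (Suc n)) * r ^ Suc n)"
proof -
  define \<omega> where "\<omega> z = deriv g z / deriv h z" for z
  have hol': "deriv h holomorphic_on unit_disk" "deriv g holomorphic_on unit_disk"
    using A B by (auto intro!: holomorphic_deriv)
  then have hol\<omega>: "\<omega> holomorphic_on unit_disk"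
    unfolding \<omega>_def using nz by (intro holomorphic_on_divide) auto
  obtain W where W: "\<omega> has_fps_expansion W"
    using has_fps_expansion_fps_expansion[OF open_ball _ hol\<omega>] by auto
  have A': "deriv h has_fps_expansion fps_deriv A" and B': "deriv g has_fps_expansion fps_deriv B"
    using A B by (auto intro: has_fps_expansion_deriv)
  have WA': "(\<lambda>z. \<omega> z * deriv h z) has_fps_expansion W * fps_deriv A"
    by (intro fps_expansion_intros W A')
  have "eventually (\<lambda>z. \<omega> z * deriv h z = deriv g z) (nhds 0)"
    using nz by (intro eventually_mono[OF eventually_nhds_in_open[of unit_disk]]) (auto simp: \<omega>_def)
  then have "deriv g has_fps_expansion W * fps_deriv A"
    using WA' has_fps_expansion_cong[OF _ refl, of "\<lambda>z. \<omega> z * deriv h z" "deriv g"] by simp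
  \<comment> \<open>Uniqueness of expansions carries \<open>g' = \<omega> h'\<close> over to formal
    power series.\<close>
  then have BWA: "fps_deriv B = W * fps_deriv A"
    by (rule fps_expansion_unique_complex[OF B'])
  have ineq: "(\<Sum>n. cmod (fps_nth (fps_deriv B) n) * t ^ n)
      \<le> k * (\<Sum>n. cmod (fps_nth (fps_deriv A) n) * t ^ n)" if t: "0 \<le> t" "t \<le> 1 / 3" for t
  proof -
    have sA: "summable (\<lambda>n. cmod (fps_nth (fps_deriv A) n) * t ^ n)"
      and sB: "summable (\<lambda>n. cmod (fps_nth (fps_deriv B) n) * t ^ n)"
      using summable_norm_fps_expansion[OF A' hol'(1)] summable_norm_fps_expansion[OF B' hol'(2)] t
      by auto
    note bohr = Bohr_inequality[OF W hol\<omega> dil[folded \<omega>_def] t]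
    have "(\<Sum>n. cmod (fps_nth (fps_deriv B) n) * t ^ n)
        \<le> (\<Sum>n. cmod (fps_nth W n) * t ^ n) * (\<Sum>n. cmod (fps_nth (fps_deriv A) n) * t ^ n)"
      using suminf_norm_fps_mult_le[OF bohr(1) sA] sB t unfolding BWA by simp
    also have "\<dots> \<le> k * (\<Sum>n. cmod (fps_nth (fps_deriv A) n) * t ^ n)"
      using t by (intro mult_right_mono bohr suminf_nonneg sA) auto
    finally show ?thesis .
  qed
  \<comment> \<open>Clearing the constant term gives \<open>P 0 = 0\<close>, so that monotonicity of
    \<open>P\<close> alone yields \<open>0 \<le> P r\<close>.\<close>
  define p where "p n = (if n = 0 then 0 else k * cmod (fps_nth A n) - cmod (fps_nth B n))" for n
  define P where "P t = (\<Sum>n. p n * t ^ n)" for t :: real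
  have sum_Suc: "summable (\<lambda>n. cmod (fps_nth A (Suc n)) * t ^ Suc n)"
      "summable (\<lambda>n. cmod (fps_nth B (Suc n)) * t ^ Suc n)" if "0 \<le> t" "t < 1" for t
    using summable_norm_fps_expansion[OF A that] summable_norm_fps_expansion[OF B that]
    by (subst summable_Suc_iff; simp)+
  have P_sums: "(\<lambda>n. p n * t ^ n) sums (k * (\<Sum>n. cmod (fps_nth A (Suc n)) * t ^ Suc n)
      - (\<Sum>n. cmod (fps_nth B (Suc n)) * t ^ Suc n))" if "0 \<le> t" "t < 1" for t
  proof -
    have "(\<lambda>n. k * (cmod (fps_nth A (Suc n)) * t ^ Suc n) - cmod (fps_nth B (Suc n)) * t ^ Suc n)
      sums (k * (\<Sum>n. cmod (fps_nth A (Suc n)) * t ^ Suc n)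
        - (\<Sum>n. cmod (fps_nth B (Suc n)) * t ^ Suc n))"
      by (intro sums_diff sums_mult summable_sums sum_Suc that)
    then have "(\<lambda>n. p (Suc n) * t ^ Suc n) sums (k * (\<Sum>n. cmod (fps_nth A (Suc n)) * t ^ Suc n)
        - (\<Sum>n. cmod (fps_nth B (Suc n)) * t ^ Suc n))"
      by (simp add: p_def algebra_simps)
    then show ?thesis
      by (subst (asm) sums_Suc_iff) (simp add: p_def)
  qed
  have "P 0 \<le> P r"
  proof (rule DERIV_nonneg_imp_nondecreasing[OF r(1)])
    fix t assume t: "0 \<le> t" "t \<le> r"
    \<comment> \<open>Convergence at \<open>1/2\<close>, a point of the disk beyond
      \<open>1/3\<close>, justifies termwise differentiation on the whole interval.\<close>
    have "(P has_real_derivative (\<Sum>n. diffs p n * t ^ n)) (at t)"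
      unfolding P_def
      by (rule termdiffs_strong[OF sums_summable[OF P_sums[of "1/2"]]]) (use t r in auto)
    \<comment> \<open>The derivative of \<open>P\<close> is the difference of the majorants of
      \<open>k h'\<close> and \<open>g'\<close>, which \<open>ineq\<close> shows to be
      nonnegative.\<close>
    moreover have "(\<lambda>n. diffs p n * t ^ n) sums (k * (\<Sum>n. cmod (fps_nth (fps_deriv A) n) * t ^ n)
        - (\<Sum>n. cmod (fps_nth (fps_deriv B) n) * t ^ n))"
    proof -
      have "(\<lambda>n. k * (cmod (fps_nth (fps_deriv A) n) * t ^ n) - cmod (fps_nth (fps_deriv B) n) * t ^ n)
        sums (k * (\<Sum>n. cmod (fps_nth (fps_deriv A) n) * t ^ n)
          - (\<Sum>n. cmod (fps_nth (fps_deriv B) n) * t ^ n))"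
        using t r summable_norm_fps_expansion[OF A' hol'(1)] summable_norm_fps_expansion[OF B' hol'(2)]
        by (intro sums_diff sums_mult summable_sums) auto
      moreover have "k * (cmod (fps_nth (fps_deriv A) n) * t ^ n) - cmod (fps_nth (fps_deriv B) n) * t ^ n
          = diffs p n * t ^ n" for n
        by (simp add: diffs_def p_def norm_mult algebra_simps del: of_nat_Suc)
      ultimately show ?thesis
        by simp
    qed
    ultimately show "\<exists>y. (P has_real_derivative y) (at t) \<and> 0 \<le> y"
      using ineq[of t] t r by (auto simp: sums_iff)
  qed
  moreover have "P 0 = 0"
    by (simp add: P_def p_def)
  ultimately show ?thesis
    using P_sums[of r] r by (simp add: P_def sums_iff)
qed

section \<open>Coefficients of functions with values in a convex domain\<close>

lemma coeff_bound_convex: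
  assumes exp: "h has_fps_expansion A" and hol: "h holomorphic_on unit_disk"
    and S: "open S" "convex S" "S \<noteq> UNIV" and sub: "h ` unit_disk \<subseteq> S" and n: "n > 0"
  shows "cmod (fps_nth A n) \<le> 2 * infdist (h 0) (frontier S)"
proof -
  define d where "d = infdist (h 0) (frontier S)"
  \<comment> \<open>Were the boundary empty, \<open>infdist\<close> would take its default value 0
    and no nearest point would exist.\<close>
  have "frontier S \<noteq> {}"
    using S(3) sub by (auto simp: frontier_eq_empty)
  then obtain p where p: "p \<in> frontier S" "d = dist (h 0) p"
    using infdist_attains_inf[OF frontier_closed] unfolding d_def by metis
  \<comment> \<open>An open set is its own relative interior, so a boundary point lies outside it,
    as the supporting hyperplane theorem demands.\<close>
  then have "p \<in> closure S" "p \<notin> rel_interior S"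
    using rel_interior_open[OF S(1)] interior_open[OF S(1)] by (auto simp: frontier_def)
  then obtain v where v: "v \<noteq> 0" "\<And>y. y \<in> closure S \<Longrightarrow> inner v p \<le> inner v y"
    using supporting_hyperplane_relative_frontier[OF S(2)] by metis
  \<comment> \<open>Multiplication by \<open>u\<close> turns the inner normal \<open>v\<close> into
    the positive real direction. Then \<open>Re (u * (h z - h 0)) \<ge> - d\<close>, and adding
    \<open>d\<close> produces a function to which Caratheodory's inequality applies, with value
    \<open>d\<close> at 0.\<close>
  define u where "u = cnj (sgn v)"
  have u: "cmod u = 1" and Re_u: "Re (u * z) = inner v z / cmod v" for z
    using v(1) by (auto simp: u_def norm_sgn sgn_div_norm inner_complex_def field_simps)
  have "cmod (fps_nth (fps_const (of_real d) + fps_const u * (A - fps_const (h 0))) n)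
      \<le> 2 * Re (of_real d + u * (h 0 - h 0))"
  proof (rule Caratheodory_coeff_bound[where F = "\<lambda>z. of_real d + u * (h z - h 0)"])
    show "(\<lambda>z. of_real d + u * (h z - h 0)) has_fps_expansion
        fps_const (of_real d) + fps_const u * (A - fps_const (h 0))"
      by (intro fps_expansion_intros exp)
    show "0 \<le> Re (of_real d + u * (h z - h 0))" if "z \<in> unit_disk" for z
    proof -
      have "inner v p \<le> inner v (h z)"
        using v(2) sub that closure_subset by blast
      then have "Re (u * (p - h 0)) \<le> Re (u * (h z - h 0))"
        unfolding Re_u by (simp add: inner_diff_right divide_right_mono)
      moreover have "\<bar>Re (u * (p - h 0))\<bar> \<le> d"
        using abs_Re_le_cmod[of "u * (p - h 0)"] u p(2)
        by (simp add: norm_mult dist_norm norm_minus_commute)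
      ultimately show ?thesis
        by simp
    qed
  qed (use hol n in \<open>auto intro!: holomorphic_intros\<close>)
  then show ?thesis
    using n u by (simp add: norm_mult d_def)
qed

text \<open>Otherwise the inverse would be a bounded entire function, hence constant by Liouville,
  yet it takes the values 0 and \<open>1/2\<close>. This ensures that the distance to the boundary
  is a genuine one.\<close>

lemma univalent_image_disk_neq_UNIV:
  assumes "\<phi> holomorphic_on unit_disk" "inj_on \<phi> unit_disk"
  shows "\<phi> ` unit_disk \<noteq> UNIV"
proof
  assume UNIV: "\<phi> ` unit_disk = UNIV"
  obtain \<psi> where hol: "\<psi> holomorphic_on \<phi> ` unit_disk" and inv: "\<And>z. z \<in> unit_disk \<Longrightarrow> \<psi> (\<phi> z) = z"
    using holomorphic_has_inverse[OF assms(1) open_ball assms(2)] by metis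
  have "range \<psi> \<subseteq> unit_disk"
    unfolding UNIV[symmetric] using inv by auto
  then have "bounded (range \<psi>)"
    using bounded_ball bounded_subset by blast
  then obtain c where "\<And>w. \<psi> w = c"
    using Liouville_theorem[of \<psi>] hol unfolding UNIV constant_on_def by auto
  then have "0 = (1 / 2 :: complex)"
    using inv[of 0] inv[of "1 / 2"] by (simp add: norm_divide)
  then show False
    by simp
qed

section \<open>The inequality up to the Bohr radius\<close>

lemma Bohr_sum_le_infdist:
  assumes K: "K \<ge> 1" and adm: "admissible K f h g a b \<phi>"
    and r: "0 \<le> r" "r \<le> (K + 1) / (5 * K + 1)"
  shows "summable (\<lambda>n. (cmod (a (Suc n)) + cmod (b (Suc n))) * r ^ Suc n)"
    and "(\<Sum>n. (cmod (a (Suc n)) + cmod (b (Suc n))) * r ^ Suc n)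
      \<le> infdist (\<phi> 0) (frontier (\<phi> ` unit_disk))"
proof -
  define k where "k = (K - 1) / (K + 1)"
  define d where "d = infdist (\<phi> 0) (frontier (\<phi> ` unit_disk))"
  define A where "A = Abs_fps a"
  \<comment> \<open>The given \<open>b 0\<close> is arbitrary, whereas the expansion of
    \<open>g\<close> has constant term 0.\<close>
  define B where "B = Abs_fps (\<lambda>n. if n = 0 then 0 else b n)"
  have hol: "h holomorphic_on unit_disk" "g holomorphic_on unit_disk"
    and jac: "\<And>z. z \<in> unit_disk \<Longrightarrow> (cmod (deriv h z))\<^sup>2 - (cmod (deriv g z))\<^sup>2 > 0"
    and dil: "\<And>z. z \<in> unit_disk \<Longrightarrow> cmod (deriv g z / deriv h z) \<le> k"
    and ser: "\<And>z. z \<in> unit_disk \<Longrightarrow> (\<lambda>n. a n * z ^ n) sums h z"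
      "\<And>z. z \<in> unit_disk \<Longrightarrow> (\<lambda>n. b (Suc n) * z ^ Suc n) sums g z"
    and \<phi>: "\<phi> holomorphic_on unit_disk" "inj_on \<phi> unit_disk" "convex (\<phi> ` unit_disk)"
    and h0: "h 0 = \<phi> 0"
    using adm unfolding admissible_def quasiconformal_harmonic_def sense_preserving_harmonic_def
      canonical_decomposition_def convex_univalent_def subordinate_def k_def by blast+
  have sub: "h ` unit_disk \<subseteq> \<phi> ` unit_disk"
  proof -
    obtain w where "\<forall>z\<in>unit_disk. cmod (w z) \<le> cmod z \<and> h z = \<phi> (w z)"
      using adm unfolding admissible_def subordinate_def by blast
    then show ?thesis
      by (force simp: image_subset_iff intro!: imageI)
  qed
  have nhds: "eventually (\<lambda>z. z \<in> unit_disk) (nhds (0::complex))"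
    by (intro eventually_nhds_in_open) auto
  have A: "h has_fps_expansion A"
    by (intro has_fps_expansionI eventually_mono[OF nhds]) (use ser(1) in \<open>simp add: A_def\<close>)
  have B: "g has_fps_expansion B"
  proof (intro has_fps_expansionI eventually_mono[OF nhds])
    fix z :: complex assume "z \<in> unit_disk"
    then have "(\<lambda>n. fps_nth B (Suc n) * z ^ Suc n) sums g z"
      using ser(2) by (simp add: B_def)
    then show "(\<lambda>n. fps_nth B n * z ^ n) sums g z"
      by (subst (asm) sums_Suc_iff) (simp add: B_def)
  qed
  have rK: "r * (5 * K + 1) \<le> K + 1"
    using r K by (simp add: pos_le_divide_eq)
  \<comment> \<open>This is equivalent to \<open>K \<ge> 1\<close> and brings \<open>r\<close> into
    the range of the majorant comparison.\<close>
  have "(K + 1) / (5 * K + 1) \<le> 1 / 3"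
    using K by (simp add: field_simps)
  with r have r3: "r \<le> 1 / 3"
    by linarith
  have k: "k \<ge> 0"
    using K by (simp add: k_def)
  have sumA: "summable (\<lambda>n. cmod (a (Suc n)) * r ^ Suc n)"
    and sumB: "summable (\<lambda>n. cmod (b (Suc n)) * r ^ Suc n)"
    using summable_norm_fps_expansion[OF A hol(1)] summable_norm_fps_expansion[OF B hol(2)] r r3
    by (subst (asm) (1 2) summable_Suc_iff[symmetric], simp add: A_def B_def)+
  then show "summable (\<lambda>n. (cmod (a (Suc n)) + cmod (b (Suc n))) * r ^ Suc n)"
    unfolding distrib_right by (rule summable_add)
  have "open (\<phi> ` unit_disk)"
    by (rule open_mapping_thm3[OF \<phi>(1) _ \<phi>(2)]) auto
  then have "cmod (fps_nth A (Suc n)) \<le> 2 * d" for n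
    using coeff_bound_convex[OF A hol(1) _ \<phi>(3) univalent_image_disk_neq_UNIV[OF \<phi>(1,2)] sub]
    by (simp add: d_def h0)
  then have le: "cmod (a (Suc n)) * r ^ Suc n \<le> 2 * d * r * r ^ n" for n
    using mult_right_mono[of "cmod (a (Suc n))" "2 * d" "r ^ Suc n"] r
    by (simp add: A_def mult.assoc)
  have geom: "(\<lambda>n. 2 * d * r * r ^ n) sums (2 * d * r * (1 / (1 - r)))"
    using r r3 by (intro sums_mult geometric_sums) auto
  have "(\<Sum>n. (cmod (a (Suc n)) + cmod (b (Suc n))) * r ^ Suc n)
      = (\<Sum>n. cmod (a (Suc n)) * r ^ Suc n) + (\<Sum>n. cmod (b (Suc n)) * r ^ Suc n)"
    unfolding distrib_right by (rule suminf_add[OF sumA sumB, symmetric])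
  \<comment> \<open>The strict Jacobian inequality excludes zeros of \<open>h'\<close>, so the
    dilatation is holomorphic.\<close>
  also have "\<dots> \<le> (1 + k) * (\<Sum>n. cmod (a (Suc n)) * r ^ Suc n)"
    using dilatation_majorant_le[OF A hol(1) B hol(2) _ dil r(1) r3] jac
    by (fastforce simp: A_def B_def algebra_simps)
  also have "\<dots> \<le> (1 + k) * (2 * d * r * (1 / (1 - r)))"
    using suminf_le[OF le sumA sums_summable[OF geom]] geom k
    by (intro mult_left_mono) (auto simp: sums_iff)
  also have "\<dots> = d * ((1 + k) * (2 * r / (1 - r)))"
    by simp
  also have "\<dots> \<le> d * 1"
  proof (rule mult_left_mono)
    have "1 + k = 2 * K / (K + 1)"
      using K by (simp add: k_def field_simps)
    then have "(1 + k) * (2 * r / (1 - r)) = 4 * K * r / ((K + 1) * (1 - r))"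
      by simp
    \<comment> \<open>Clearing denominators gives \<open>4 * K * r \<le> (K + 1) * (1 - r)\<close>,
      which is \<open>rK\<close>; this is the origin of the radius.\<close>
    also have "\<dots> \<le> 1"
      using rK r3 K by (subst pos_divide_le_eq) (auto simp: algebra_simps)
    finally show "(1 + k) * (2 * r / (1 - r)) \<le> 1" .
  qed (simp add: d_def infdist_nonneg)
  finally show "(\<Sum>n. (cmod (a (Suc n)) + cmod (b (Suc n))) * r ^ Suc n)
      \<le> infdist (\<phi> 0) (frontier (\<phi> ` unit_disk))"
    by (simp add: d_def)
qed

section \<open>Sharpness: the half-plane mapping\<close>

text \<open>By the Cauchy-Riemann equations the first partial derivatives are \<open>Re F'\<close>
  and \<open>- Im F'\<close>, and the pure second ones are \<open>Re F''\<close> and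
  \<open>- Re F''\<close>, which cancel.\<close>

lemma harmonic_real_Re_holomorphic:
  assumes F: "F holomorphic_on S" and S: "open S"
  shows "harmonic_real (\<lambda>z. Re (F z)) S"
proof -
  define F1 where "F1 = deriv F"
  define F2 where "F2 = deriv F1"
  have hol: "F1 holomorphic_on S" "F2 holomorphic_on S"
    unfolding F2_def F1_def by (intro holomorphic_deriv F S)+
  have Re: "((\<lambda>z. Re (G z)) has_derivative (\<lambda>v. Re (D * v))) (at z)"
    and Im: "((\<lambda>z. Im (G z)) has_derivative (\<lambda>v. Im (D * v))) (at z)"
    if "(G has_field_derivative D) (at z)" for G D z
    using bounded_linear.has_derivative[OF bounded_linear_Re that[unfolded has_field_derivative_def]]
      bounded_linear.has_derivative[OF bounded_linear_Im that[unfolded has_field_derivative_def]]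
    by simp_all
  have D: "(F has_field_derivative F1 z) (at z)" "(F1 has_field_derivative F2 z) (at z)"
    if "z \<in> S" for z
    using that S F hol unfolding F1_def F2_def by (auto intro: holomorphic_derivI)
  have cont: "continuous_on S F2"
    using hol by (simp add: holomorphic_on_imp_continuous_on)
  show ?thesis
    unfolding harmonic_real_def
  proof (intro conjI exI ballI)
    fix z assume z: "z \<in> S"
    show "((\<lambda>z. Re (F z)) has_derivative (\<lambda>v. Re (F1 z) * Re v + - Im (F1 z) * Im v)) (at z)"
      using Re[OF D(1)[OF z]] by simp
    show "((\<lambda>z. Re (F1 z)) has_derivative (\<lambda>v. Re (F2 z) * Re v + - Im (F2 z) * Im v)) (at z)"
      using Re[OF D(2)[OF z]] by simp
    show "((\<lambda>z. - Im (F1 z)) has_derivative (\<lambda>v. - Im (F2 z) * Re v + - Re (F2 z) * Im v)) (at z)"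
      using has_derivative_minus[OF Im[OF D(2)[OF z]]] by (simp add: algebra_simps)
  qed (use S cont in \<open>auto intro!: continuous_intros\<close>)
qed

text \<open>The inverse map is \<open>w / (1 + w)\<close>, and \<open>cmod w < cmod (1 + w)\<close>
  says that \<open>w\<close> is nearer to 0 than to -1, that is, to the right of the perpendicular
  bisector.\<close>

lemma image_disk_half_plane: "(\<lambda>z. z / (1 - z)) ` unit_disk = {w. Re w > - 1 / 2}"
proof -
  have less_iff: "cmod w < cmod (1 + w) \<longleftrightarrow> Re w > - 1 / 2" for w
    unfolding cmod_def by (simp add: power2_eq_square algebra_simps) linarith
  have "z / (1 - z) \<in> {w. Re w > - 1 / 2}" if "z \<in> unit_disk" for z
  proof -
    have nz: "z \<noteq> 1" using that by auto
    then have "1 + z / (1 - z) = 1 / (1 - z)" by (simp add: field_simps)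
    then have "cmod (z / (1 - z)) < cmod (1 + z / (1 - z))"
      using that nz by (simp add: norm_divide divide_strict_right_mono)
    then show ?thesis by (simp add: less_iff)
  qed
  moreover have "w \<in> (\<lambda>z. z / (1 - z)) ` unit_disk" if "Re w > - 1 / 2" for w
  proof (rule image_eqI[where x = "w / (1 + w)"])
    have nz: "1 + w \<noteq> 0" using that by (auto simp: complex_eq_iff)
    then have "1 - w / (1 + w) = 1 / (1 + w)" by (simp add: field_simps)
    with nz show "w = w / (1 + w) / (1 - w / (1 + w))" by simp
    show "w / (1 + w) \<in> unit_disk"
      using nz that less_iff[of w] by (simp add: norm_divide)
  qed
  ultimately show ?thesis by blast
qed

lemma half_plane_map_admissible:
  fixes K :: real
  defines "k \<equiv> (K - 1) / (K + 1)"
  defines "h \<equiv> \<lambda>z. z / (1 - z)"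
  assumes K: "K \<ge> 1"
  shows "admissible K (\<lambda>z. h z + cnj (of_real k * h z)) h (\<lambda>z. of_real k * h z)
    (\<lambda>n. if n = 0 then 0 else 1) (\<lambda>n. of_real k) h"
proof -
  have k: "0 \<le> k" "k < 1"
    using K by (auto simp: k_def)
  have ne1: "z \<noteq> 1" if "z \<in> unit_disk" for z :: complex
    using that by auto
  have hol: "h holomorphic_on unit_disk"
    unfolding h_def using ne1 by (intro holomorphic_intros) auto
  have inj: "inj_on h unit_disk"
    by (rule inj_onI) (use ne1 in \<open>auto simp: h_def field_simps\<close>)
  have dh: "(h has_field_derivative 1 / (1 - z)\<^sup>2) (at z)" if "z \<in> unit_disk" for z
    unfolding h_def using ne1[OF that]
    by (auto intro!: derivative_eq_intros simp: field_simps power2_eq_square)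
  have dg: "deriv (\<lambda>z. of_real k * h z) z = of_real k * deriv h z" if "z \<in> unit_disk" for z
    using DERIV_imp_deriv[OF DERIV_cmult[OF dh[OF that]]] DERIV_imp_deriv[OF dh[OF that]] by simp
  have nz: "deriv h z \<noteq> 0" if "z \<in> unit_disk" for z
    using DERIV_imp_deriv[OF dh[OF that]] ne1[OF that] by simp
  let ?f = "\<lambda>z. h z + cnj (of_real k * h z)"
  have Re_f: "Re (?f z) = Re ((1 + of_real k) * h z)" for z
    by (simp add: algebra_simps)
  \<comment> \<open>Writing the imaginary part as the real part of a holomorphic function lets one
    harmonicity lemma serve for both.\<close>
  have Im_f: "Im (?f z) = Re (- \<i> * (1 - of_real k) * h z)" for z
    by (simp add: algebra_simps)
  have inj_f: "inj_on ?f unit_disk"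
  proof (rule inj_onI)
    fix z w assume zw: "z \<in> unit_disk" "w \<in> unit_disk" "?f z = ?f w"
    \<comment> \<open>The mapping is \<open>h\<close> followed by a stretch of the axes by
      \<open>1 + k\<close> and \<open>1 - k\<close>, which is injective because
      \<open>k < 1\<close>.\<close>
    then have "(1 + k) * Re (h z) = (1 + k) * Re (h w)" "(1 - k) * Im (h z) = (1 - k) * Im (h w)"
      by (auto simp: complex_eq_iff algebra_simps)
    then have "h z = h w"
      using k by (simp add: complex_eq_iff)
    with zw inj show "z = w"
      by (auto dest: inj_onD)
  qed
  have jac: "(cmod (deriv h z))\<^sup>2 - (cmod (deriv (\<lambda>z. of_real k * h z) z))\<^sup>2 > 0"
    if "z \<in> unit_disk" for z
  proof -
    have "k\<^sup>2 < 1"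
      using k by (simp add: power_less_one_iff)
    then have "0 < (1 - k\<^sup>2) * (cmod (deriv h z))\<^sup>2"
      using nz[OF that] by simp
    then show ?thesis
      using dg[OF that] by (simp add: norm_mult power_mult_distrib algebra_simps)
  qed
  have harm: "harmonic_mapping ?f"
    unfolding harmonic_mapping_def Re_f Im_f
    by (intro conjI harmonic_real_Re_holomorphic holomorphic_intros hol open_ball)
  have "locally_univalent ?f"
    unfolding locally_univalent_def using inj_f by (intro ballI exI[of _ unit_disk]) auto
  with harm have sense: "sense_preserving_harmonic ?f h (\<lambda>z. of_real k * h z)"
    unfolding sense_preserving_harmonic_def canonical_decomposition_def
    using hol jac by (auto intro!: holomorphic_intros simp: h_def)
  have "cmod (deriv (\<lambda>z. of_real k * h z) z / deriv h z) \<le> k" if "z \<in> unit_disk" for z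
    using dg[OF that] nz[OF that] k by simp
  with sense have qc: "quasiconformal_harmonic K ?f h (\<lambda>z. of_real k * h z)"
    unfolding quasiconformal_harmonic_def k_def by blast
  have conv: "convex_univalent h"
    unfolding convex_univalent_def using hol inj image_disk_half_plane convex_halfspace_Re_gt
    by (simp add: h_def)
  have sub: "subordinate h h"
    unfolding subordinate_def by (auto intro!: exI[of _ "\<lambda>z. z"])
  have geom: "(\<lambda>n. z ^ Suc n) sums h z" if "z \<in> unit_disk" for z
    using sums_mult[OF geometric_sums[of z], of z] that by (simp add: h_def)
  have "(\<lambda>n. (if n = 0 then 0 else 1) * z ^ n) sums h z" if "z \<in> unit_disk" for z
    using geom[OF that] sums_Suc_iff[of "\<lambda>n. (if n = 0 then 0 else 1) * z ^ n" "h z"] by simp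
  then show ?thesis
    unfolding admissible_def
    by (intro conjI ballI qc conv sub) (use sums_mult[OF geom] in auto)
qed

text \<open>The boundary point \<open>-1/2\<close> bounds the distance by \<open>1/2\<close>, and
  \<open>(1 + k) * \<rho> / (1 - \<rho>)\<close> exceeds \<open>1/2\<close> exactly when
  \<open>\<rho>\<close> exceeds the radius: the computation of the upper estimate, read with strict
  inequality the other way.\<close>

lemma half_plane_map_Bohr_sum_gt:
  fixes K :: real
  defines "k \<equiv> (K - 1) / (K + 1)"
  assumes K: "K \<ge> 1" and \<rho>: "(K + 1) / (5 * K + 1) < \<rho>" "\<rho> < 1"
  shows "\<exists>s. (\<lambda>n. (1 + k) * \<rho> ^ Suc n) sums s \<and>
    infdist 0 (frontier ((\<lambda>z. z / (1 - z)) ` unit_disk)) < s"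
proof (intro exI conjI)
  have rho_pos: "0 < \<rho>"
    by (rule le_less_trans[OF _ \<rho>(1)]) (use K in simp)
  show "(\<lambda>n. (1 + k) * \<rho> ^ Suc n) sums ((1 + k) * (\<rho> * (1 / (1 - \<rho>))))"
    unfolding power_Suc by (intro sums_mult geometric_sums) (use \<rho> rho_pos in auto)
  have "{w. Re w > - 1 / 2} = {w. inner 1 w > - 1 / 2}"
    by (simp add: inner_complex_def)
  then have "- 1 / 2 \<in> frontier {w. Re w > - 1 / 2}"
    using frontier_halfspace_gt[of "1::complex" "- 1 / 2"] by (simp add: inner_complex_def)
  then have "infdist 0 (frontier {w. Re w > - 1 / 2}) \<le> dist 0 (- 1 / 2 :: complex)"
    by (rule infdist_le)
  also have "\<dots> = 1 / 2"
    by (simp add: norm_divide)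
  also have "1 / 2 < (1 + k) * (\<rho> * (1 / (1 - \<rho>)))"
  proof -
    have "K + 1 < \<rho> * (5 * K + 1)"
      using \<rho>(1) K by (simp add: pos_divide_less_eq)
    then have "(K + 1) * (1 - \<rho>) < 2 * (2 * K * \<rho>)"
      by (simp add: algebra_simps)
    then have "1 / 2 * ((K + 1) * (1 - \<rho>)) < 2 * K * \<rho>"
      by linarith
    moreover have "0 < (K + 1) * (1 - \<rho>)"
      using \<rho>(2) K by simp
    ultimately have "1 / 2 < 2 * K * \<rho> / ((K + 1) * (1 - \<rho>))"
      by (simp only: pos_less_divide_eq)
    also have "1 + k = 2 * K / (K + 1)"
      using K by (simp add: k_def field_simps)
    then have "2 * K * \<rho> / ((K + 1) * (1 - \<rho>)) = (1 + k) * (\<rho> * (1 / (1 - \<rho>)))"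
      by simp
    finally show ?thesis .
  qed
  finally show "infdist 0 (frontier ((\<lambda>z. z / (1 - z)) ` unit_disk)) < (1 + k) * (\<rho> * (1 / (1 - \<rho>)))"
    by (simp only: image_disk_half_plane)
qed

theorem theorem1:
  fixes K :: real
  assumes "K \<ge> 1"
  shows
    "(\<forall>f h g a b \<phi>. admissible K f h g a b \<phi> \<longrightarrow>
        (\<forall>r. 0 \<le> r \<and> r \<le> (K + 1) / (5 * K + 1) \<longrightarrow>
           summable (\<lambda>n. (cmod (a (Suc n)) + cmod (b (Suc n))) * r ^ Suc n) \<and>
           (\<Sum>n. (cmod (a (Suc n)) + cmod (b (Suc n))) * r ^ Suc n)
             \<le> infdist (\<phi> 0) (frontier (\<phi> ` unit_disk)))) \<and>
     (\<forall>\<rho>. (K + 1) / (5 * K + 1) < \<rho> \<and> \<rho> < 1 \<longrightarrow>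
        (\<exists>f h g a b \<phi>. admissible K f h g a b \<phi> \<and>
          (\<exists>r. 0 \<le> r \<and> r \<le> \<rho> \<and>
             summable (\<lambda>n. (cmod (a (Suc n)) + cmod (b (Suc n))) * r ^ Suc n) \<and>
             (\<Sum>n. (cmod (a (Suc n)) + cmod (b (Suc n))) * r ^ Suc n)
               > infdist (\<phi> 0) (frontier (\<phi> ` unit_disk)))))"
proof (rule conjI; intro allI impI; elim conjE)
  fix f h g a b \<phi> r
  assume "admissible K f h g a b \<phi>" "0 \<le> r" "r \<le> (K + 1) / (5 * K + 1)"
  with assms show "summable (\<lambda>n. (cmod (a (Suc n)) + cmod (b (Suc n))) * r ^ Suc n) \<and>
      (\<Sum>n. (cmod (a (Suc n)) + cmod (b (Suc n))) * r ^ Suc n)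
        \<le> infdist (\<phi> 0) (frontier (\<phi> ` unit_disk))"
    by (blast intro: Bohr_sum_le_infdist)
next
  fix \<rho> :: real assume \<rho>: "(K + 1) / (5 * K + 1) < \<rho>" "\<rho> < 1"
  define k where "k = (K - 1) / (K + 1)"
  have k: "0 \<le> k"
    using assms by (simp add: k_def)
  define h where "h = (\<lambda>z::complex. z / (1 - z))"
  define a where "a n = (if n = 0 then 0 else 1 :: complex)" for n :: nat
  \<comment> \<open>The value at index 0 is free, since \<open>admissible\<close> reads
    \<open>b\<close> from index 1 on.\<close>
  define b where "b n = complex_of_real k" for n :: nat
  have "admissible K (\<lambda>z. h z + cnj (of_real k * h z)) h (\<lambda>z. of_real k * h z) a b h"
    using half_plane_map_admissible[OF assms] by (simp add: k_def h_def a_def[abs_def] b_def[abs_def])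
  moreover have "cmod (a (Suc n)) + cmod (b (Suc n)) = 1 + k" for n
    using k by (simp add: a_def b_def)
  then have "summable (\<lambda>n. (cmod (a (Suc n)) + cmod (b (Suc n))) * \<rho> ^ Suc n) \<and>
      (\<Sum>n. (cmod (a (Suc n)) + cmod (b (Suc n))) * \<rho> ^ Suc n)
        > infdist (h 0) (frontier (h ` unit_disk))"
    using half_plane_map_Bohr_sum_gt[OF assms \<rho>, folded k_def]
    unfolding h_def by (auto simp: sums_iff simp del: power_Suc)
  \<comment> \<open>The witness for \<open>r\<close> is \<open>\<rho>\<close> itself.\<close>
  moreover have "0 \<le> \<rho>"
    by (rule order_trans[OF _ less_imp_le[OF \<rho>(1)]]) (use assms in simp)
  ultimately show "\<exists>f h g a b \<phi>. admissible K f h g a b \<phi> \<and>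
      (\<exists>r. 0 \<le> r \<and> r \<le> \<rho> \<and>
         summable (\<lambda>n. (cmod (a (Suc n)) + cmod (b (Suc n))) * r ^ Suc n) \<and>
         (\<Sum>n. (cmod (a (Suc n)) + cmod (b (Suc n))) * r ^ Suc n)
           > infdist (\<phi> 0) (frontier (\<phi> ` unit_disk)))"
    by blast
qed

end
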